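(* Tarski's relevance logic has the variable-sharing property, even when extended by axioms ensuring commutativity and density: if $A,B$ are formulas and $A\to B\in\mathcal{L}_4$, then some propositional variable occurs in both $A$ and $B$; and the same holds with $\mathcal{L}_4$ replaced by its extension $\mathcal{L}_4^{+}$ defined in the context.
   Context: Formulas are built from a countable set of propositional variables using the binary connectives $\lor,\land,\to$ and the unary connective $\sim$. An assertion $A_{ij}$ is a formula $A$ together with an ordered pair of indices $i,j\in\{0,1,2,3\}$. A sequent $\Gamma\Rightarrow\Delta$ is an ordered pair of sets of assertions; commas denote union, and either side may be empty. A 4-proof is a finite sequence of sequents each of which is an Axiom or follows from one or two earlier sequents by a rule below ($\Gamma,\Gamma',\Delta,\Delta'$ are arbitrary sets of assertions, $i,j,k\in\{0,1,2,3\}$): - Axiom: $\Gamma\Rightarrow\Delta$ whenever $\Gamma\cap\Delta\neq\emptyset$. - Cut: from $\Gamma\Rightarrow\Delta,A_{ij}$ and $A_{ij},\Gamma'\Rightarrow\Delta'$ infer $\Gamma,\Gamma'\Rightarrow\Delta,\Delta'$. - Weakening: from $\Gamma\Rightarrow\Delta$ infer $\Gamma,\Gamma'\Rightarrow\Delta,\Delta'$. - $\lor|$: from $\Gamma,A_{ij}\Rightarrow\Delta$ and $\Gamma',B_{ij}\Rightarrow\Delta'$ infer $\Gamma,\Gamma',(A\lor B)_{ij}\Rightarrow\Delta,\Delta'$. - $|\lor$: from $\Gamma\Rightarrow\Delta,A_{ij},B_{ij}$ infer $\Gamma\Rightarrow\Delta,(A\lor B)_{ij}$. - $\land|$: from $\Gamma,A_{ij},B_{ij}\Rightarrow\Delta$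 infer $\Gamma,(A\land B)_{ij}\Rightarrow\Delta$. - $|\land$: from $\Gamma\Rightarrow\Delta,A_{ij}$ and $\Gamma'\Rightarrow\Delta',B_{ij}$ infer $\Gamma,\Gamma'\Rightarrow\Delta,\Delta',(A\land B)_{ij}$. - ${\sim}|$: from $\Gamma\Rightarrow\Delta,A_{ij}$ infer $\Gamma,({\sim}A)_{ji}\Rightarrow\Delta$. - $|{\sim}$: from $\Gamma,A_{ij}\Rightarrow\Delta$ infer $\Gamma\Rightarrow\Delta,({\sim}A)_{ji}$. - ${\to}|$: from $\Gamma\Rightarrow\Delta,A_{ki}$ and $\Gamma',B_{kj}\Rightarrow\Delta'$ infer $\Gamma,\Gamma',(A\to B)_{ij}\Rightarrow\Delta,\Delta'$. - $|{\to}$: from $\Gamma,A_{ki}\Rightarrow\Delta,B_{kj}$ infer $\Gamma\Rightarrow\Delta,(A\to B)_{ij}$, provided $k\neq i,j$ and $k$ does not occur as a subscript in any assertion of $\Gamma\cup\Delta$. Tarski's relevance logic $\mathcal{L}_4$ is the set of formulas $A$ such that the sequent $\Rightarrow A_{00}$ appears in some 4-proof. The extension $\mathcal{L}_4^{+}$ is defined in the same way, but allowing as additional axioms in proofs all sequents $\Gamma,X_{ij}\Rightarrow\Delta,Y_{ij}$, where $i,j\in\{0,1,2,3\}$ and $X\to Y$ is any instance (with $A,B,C$ arbitrary formulas) of one of the schemes: $(A\to{\sim}B)\to(B\to{\sim}A)$; $(A\to(B\to C))\to(B\to(A\to C))$; $(A\to B)\to((B\to C)\to(A\to C))$; $A\to((A\to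 B)\to B)$; $(A\to(A\to B))\to(A\to B)$; $(A\to{\sim}A)\to{\sim}A$. *)

theory Defs
  imports "HOL-Library.Countable"
begin

(* The type parameter is the set of propositional variables; vars A is the set of
   variables occurring in A. *)
datatype (vars: 'v) fm =
    Var 'v
  | Or "'v fm" "'v fm"  (infixr "\<^bold>\<or>" 60)
  | And "'v fm" "'v fm"  (infixr "\<^bold>\<and>" 65)
  | Imp "'v fm" "'v fm"  (infixr "\<^bold>\<rightarrow>" 55)
  | Neg "'v fm"  ("\<^bold>\<sim> _" [70] 70)

datatype index = I0 | I1 | I2 | I3

(* (A, i, j) stands for the assertion A with subscripts ij; (\<Gamma>, \<Delta>) for the sequent with
   left side \<Gamma> and right side \<Delta>. The sides are arbitrary, possibly infinite, sets. *)
type_synonym 'v assertion = "'v fm \<times> index \<times> index"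
type_synonym 'v sequent = "'v assertion set \<times> 'v assertion set"

definition subscripts :: "'v assertion set \<Rightarrow> index set" where
  "subscripts \<Gamma> = {k. \<exists>A i j. (A, i, j) \<in> \<Gamma> \<and> (k = i \<or> k = j)}"

(* step \<A> P s: the sequent s is an axiom, belongs to the set \<A> of additional axioms, or follows
   by one of the rules from sequents in P. A comma on either side of a sequent is a union, so the
   displayed assertion is allowed to belong to \<Gamma> or \<Delta> as well. *)
inductive step :: "'v sequent set \<Rightarrow> 'v sequent set \<Rightarrow> 'v sequent \<Rightarrow> bool"
  for \<A> :: "'v sequent set" and P :: "'v sequent set" where
  Ax: "\<Gamma> \<inter> \<Delta> \<noteq> {} \<Longrightarrow> step \<A> P (\<Gamma>, \<Delta>)"
| ExtraAx: "s \<in> \<A> \<Longrightarrow> step \<A> P s"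
| Cut: "(\<Gamma>, \<Delta> \<union> {(A, i, j)}) \<in> P \<Longrightarrow> ({(A, i, j)} \<union> \<Gamma>', \<Delta>') \<in> P
    \<Longrightarrow> step \<A> P (\<Gamma> \<union> \<Gamma>', \<Delta> \<union> \<Delta>')"
| Weakening: "(\<Gamma>, \<Delta>) \<in> P \<Longrightarrow> step \<A> P (\<Gamma> \<union> \<Gamma>', \<Delta> \<union> \<Delta>')"
| OrL: "(\<Gamma> \<union> {(A, i, j)}, \<Delta>) \<in> P \<Longrightarrow> (\<Gamma>' \<union> {(B, i, j)}, \<Delta>') \<in> P
    \<Longrightarrow> step \<A> P (\<Gamma> \<union> \<Gamma>' \<union> {(A \<^bold>\<or> B, i, j)}, \<Delta> \<union> \<Delta>')"
| OrR: "(\<Gamma>, \<Delta> \<union> {(A, i, j), (B, i, j)}) \<in> P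
    \<Longrightarrow> step \<A> P (\<Gamma>, \<Delta> \<union> {(A \<^bold>\<or> B, i, j)})"
| AndL: "(\<Gamma> \<union> {(A, i, j), (B, i, j)}, \<Delta>) \<in> P
    \<Longrightarrow> step \<A> P (\<Gamma> \<union> {(A \<^bold>\<and> B, i, j)}, \<Delta>)"
| AndR: "(\<Gamma>, \<Delta> \<union> {(A, i, j)}) \<in> P \<Longrightarrow> (\<Gamma>', \<Delta>' \<union> {(B, i, j)}) \<in> P
    \<Longrightarrow> step \<A> P (\<Gamma> \<union> \<Gamma>', \<Delta> \<union> \<Delta>' \<union> {(A \<^bold>\<and> B, i, j)})"
| NegL: "(\<Gamma>, \<Delta> \<union> {(A, i, j)}) \<in> P \<Longrightarrow> step \<A> P (\<Gamma> \<union> {(\<^bold>\<sim> A, j, i)}, \<Delta>)"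
| NegR: "(\<Gamma> \<union> {(A, i, j)}, \<Delta>) \<in> P \<Longrightarrow> step \<A> P (\<Gamma>, \<Delta> \<union> {(\<^bold>\<sim> A, j, i)})"
| ImpL: "(\<Gamma>, \<Delta> \<union> {(A, k, i)}) \<in> P \<Longrightarrow> (\<Gamma>' \<union> {(B, k, j)}, \<Delta>') \<in> P
    \<Longrightarrow> step \<A> P (\<Gamma> \<union> \<Gamma>' \<union> {(A \<^bold>\<rightarrow> B, i, j)}, \<Delta> \<union> \<Delta>')"
| ImpR: "(\<Gamma> \<union> {(A, k, i)}, \<Delta> \<union> {(B, k, j)}) \<in> P
    \<Longrightarrow> k \<noteq> i \<Longrightarrow> k \<noteq> j \<Longrightarrow> k \<notin> subscripts (\<Gamma> \<union> \<Delta>)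
    \<Longrightarrow> step \<A> P (\<Gamma>, \<Delta> \<union> {(A \<^bold>\<rightarrow> B, i, j)})"

definition four_proof :: "'v sequent set \<Rightarrow> 'v sequent list \<Rightarrow> bool" where
  "four_proof \<A> ss \<longleftrightarrow> (\<forall>n < length ss. step \<A> (set (take n ss)) (ss ! n))"

definition logic :: "'v sequent set \<Rightarrow> 'v fm set" where
  "logic \<A> = {A. \<exists>ss. four_proof \<A> ss \<and> ({}, {(A, I0, I0)}) \<in> set ss}"

definition L4 :: "'v fm set" where
  "L4 = logic {}"

inductive_set plus_schemes :: "'v fm set" where
  "(A \<^bold>\<rightarrow> \<^bold>\<sim> B) \<^bold>\<rightarrow> (B \<^bold>\<rightarrow> \<^bold>\<sim> A) \<in> plus_schemes"
| "(A \<^bold>\<rightarrow> (B \<^bold>\<rightarrow> C)) \<^bold>\<rightarrow> (B \<^bold>\<rightarrow> (A \<^bold>\<rightarrow> C)) \<in> plus_schemes"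
| "(A \<^bold>\<rightarrow> B) \<^bold>\<rightarrow> ((B \<^bold>\<rightarrow> C) \<^bold>\<rightarrow> (A \<^bold>\<rightarrow> C)) \<in> plus_schemes"
| "A \<^bold>\<rightarrow> ((A \<^bold>\<rightarrow> B) \<^bold>\<rightarrow> B) \<in> plus_schemes"
| "(A \<^bold>\<rightarrow> (A \<^bold>\<rightarrow> B)) \<^bold>\<rightarrow> (A \<^bold>\<rightarrow> B) \<in> plus_schemes"
| "(A \<^bold>\<rightarrow> \<^bold>\<sim> A) \<^bold>\<rightarrow> \<^bold>\<sim> A \<in> plus_schemes"

definition plus_axioms :: "'v sequent set" where
  "plus_axioms = {(\<Gamma> \<union> {(X, i, j)}, \<Delta> \<union> {(Y, i, j)}) | \<Gamma> \<Delta> X Y i j. X \<^bold>\<rightarrow> Y \<in> plus_schemes}"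

definition L4_plus :: "'v fm set" where
  "L4_plus = logic plus_axioms"

end

theory Submission
  imports Defs Complex_Main
begin

text \<open>
  Formulas are read as binary relations: \<open>\<^bold>\<or>\<close> and \<open>\<^bold>\<and>\<close> are union and intersection, \<open>\<^bold>\<sim>\<close> is the
  complement of the converse, and \<open>A \<^bold>\<rightarrow> B\<close> is the residual, the largest \<open>R\<close> such that \<open>A\<close>
  followed by \<open>R\<close> is contained in \<open>B\<close>. If the four indices are read as arbitrary points, every
  rule preserves truth (\<open>step_sound\<close>): the side condition of the last rule allows the point of
  \<open>k\<close> to be chosen freely, as a residual requires. A theorem of the logic therefore denotes a
  reflexive relation, and a theorem of the form \<open>A \<^bold>\<rightarrow> B\<close> forces the inclusion of \<open>A\<close> in \<open>B\<close>.

  The points are taken to be the elements of an ordered field, and the variables denote relations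
  that are invariant under the maps \<open>x \<mapsto> a * x + b\<close> with \<open>a > 0\<close>. Invariance is inherited by all
  formulas. Translations make any two invariant relations commute under composition, and
  contractions by the factor \<open>1/2\<close> make each of them dense (\<open>R\<close> contained in \<open>R\<close> composed with
  itself); these two properties give the additional axioms (\<open>plus_scheme_sound\<close>).

  Finally, the relations \<open><\<close> and \<open>\<le>\<close> alone are closed under the four connectives, and so are
  \<open>>\<close> and \<open>\<ge>\<close>, but no member of the first pair is included in a member of the second. If \<open>A\<close>
  and \<open>B\<close> have no variable in common, let the variables of \<open>A\<close> denote \<open><\<close> and all others \<open>>\<close>.
  Then \<open>A\<close> is not included in \<open>B\<close>, so \<open>A \<^bold>\<rightarrow> B\<close> is not a theorem.
\<close>

section \<open>Relational semantics and soundness\<close>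

primrec rel :: "('v \<Rightarrow> 'a \<Rightarrow> 'a \<Rightarrow> bool) \<Rightarrow> 'v fm \<Rightarrow> 'a \<Rightarrow> 'a \<Rightarrow> bool" where
  "rel v (Var p) x y \<longleftrightarrow> v p x y"
| "rel v (A \<^bold>\<or> B) x y \<longleftrightarrow> rel v A x y \<or> rel v B x y"
| "rel v (A \<^bold>\<and> B) x y \<longleftrightarrow> rel v A x y \<and> rel v B x y"
| "rel v (A \<^bold>\<rightarrow> B) x y \<longleftrightarrow> (\<forall>z. rel v A z x \<longrightarrow> rel v B z y)"
| "rel v (\<^bold>\<sim> A) x y \<longleftrightarrow> \<not> rel v A y x"

fun holds :: "('v \<Rightarrow> 'a \<Rightarrow> 'a \<Rightarrow> bool) \<Rightarrow> (index \<Rightarrow> 'a) \<Rightarrow> 'v assertion \<Rightarrow> bool" where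
  "holds v s (A, i, j) \<longleftrightarrow> rel v A (s i) (s j)"

definition valid :: "('v \<Rightarrow> 'a \<Rightarrow> 'a \<Rightarrow> bool) \<Rightarrow> 'v sequent \<Rightarrow> bool" where
  "valid v S \<longleftrightarrow> (\<forall>s. (\<forall>\<phi>\<in>fst S. holds v s \<phi>) \<longrightarrow> (\<exists>\<phi>\<in>snd S. holds v s \<phi>))"

lemma holds_upd_fresh:
  assumes "\<phi> \<in> \<Gamma>" and "k \<notin> subscripts \<Gamma>"
  shows "holds v (s(k := z)) \<phi> \<longleftrightarrow> holds v s \<phi>"
proof -
  obtain A i j where \<phi>: "\<phi> = (A, i, j)"
    by (cases \<phi>)
  with assms have "k \<noteq> i" "k \<noteq> j"
    unfolding subscripts_def by blast+
  then show ?thesis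
    using \<phi> by simp
qed

lemma valid_ImpR:
  assumes prem: "valid v (\<Gamma> \<union> {(A, k, i)}, \<Delta> \<union> {(B, k, j)})"
    and k: "k \<noteq> i" "k \<noteq> j" "k \<notin> subscripts (\<Gamma> \<union> \<Delta>)"
  shows "valid v (\<Gamma>, \<Delta> \<union> {(A \<^bold>\<rightarrow> B, i, j)})"
  unfolding valid_def
proof (intro allI impI)
  fix s assume "\<forall>\<phi>\<in>fst (\<Gamma>, \<Delta> \<union> {(A \<^bold>\<rightarrow> B, i, j)}). holds v s \<phi>"
  then have \<Gamma>: "\<forall>\<phi>\<in>\<Gamma>. holds v s \<phi>"
    by simp
  show "\<exists>\<phi>\<in>snd (\<Gamma>, \<Delta> \<union> {(A \<^bold>\<rightarrow> B, i, j)}). holds v s \<phi>"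
  proof (cases "\<exists>\<phi>\<in>\<Delta>. holds v s \<phi>")
    case False
    have "rel v B z (s j)" if z: "rel v A z (s i)" for z
    proof -
      let ?t = "s(k := z)"
      have same: "holds v ?t \<phi> \<longleftrightarrow> holds v s \<phi>" if "\<phi> \<in> \<Gamma> \<union> \<Delta>" for \<phi>
        using that k(3) by (rule holds_upd_fresh)
      have "\<forall>\<phi>\<in>\<Gamma> \<union> {(A, k, i)}. holds v ?t \<phi>"
        using \<Gamma> same z k by auto
      then obtain \<phi> where "\<phi> \<in> \<Delta> \<union> {(B, k, j)}" "holds v ?t \<phi>"
        using prem unfolding valid_def by fastforce
      moreover have "\<phi> \<notin> \<Delta>"
        using \<open>holds v ?t \<phi>\<close> same False by blast
      ultimately show ?thesis
        using k by auto
    qed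
    then show ?thesis
      by simp
  qed auto
qed

lemma step_sound:
  assumes "step \<A> P S" and "\<forall>T\<in>\<A>. valid v T" and "\<forall>T\<in>P. valid v T"
  shows "valid v S"
  using assms
proof (induction rule: step.induct)
  case (ImpR \<Gamma> A k i \<Delta> B j)
  then show ?case
    by (intro valid_ImpR[where k = k]) auto
next
  case (Ax \<Gamma> \<Delta>)
  then show ?case
    unfolding valid_def by auto
next
  case (ExtraAx s)
  then show ?case by blast
next
  case (Cut \<Gamma> \<Delta> A i j \<Gamma>' \<Delta>')
  then have "valid v (\<Gamma>, \<Delta> \<union> {(A, i, j)})" "valid v ({(A, i, j)} \<union> \<Gamma>', \<Delta>')"
    by auto
  then show ?case
    unfolding valid_def by (simp add: ball_Un bex_Un; blast)
next
  case (Weakening \<Gamma> \<Delta> \<Gamma>' \<Delta>')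
  then have "valid v (\<Gamma>, \<Delta>)"
    by auto
  then show ?case
    unfolding valid_def by (simp add: ball_Un bex_Un)
next
  case (OrL \<Gamma> A i j \<Delta> \<Gamma>' B \<Delta>')
  then have "valid v (\<Gamma> \<union> {(A, i, j)}, \<Delta>)" "valid v (\<Gamma>' \<union> {(B, i, j)}, \<Delta>')"
    by auto
  then show ?case
    unfolding valid_def by (simp add: ball_Un bex_Un; blast)
next
  case (OrR \<Gamma> \<Delta> A i j B)
  then have "valid v (\<Gamma>, \<Delta> \<union> {(A, i, j), (B, i, j)})"
    by auto
  then show ?case
    unfolding valid_def by (simp add: ball_Un bex_Un; blast)
next
  case (AndL \<Gamma> A i j B \<Delta>)
  then have "valid v (\<Gamma> \<union> {(A, i, j), (B, i, j)}, \<Delta>)"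
    by auto
  then show ?case
    unfolding valid_def by (simp add: ball_Un bex_Un)
next
  case (AndR \<Gamma> \<Delta> A i j \<Gamma>' \<Delta>' B)
  then have "valid v (\<Gamma>, \<Delta> \<union> {(A, i, j)})" "valid v (\<Gamma>', \<Delta>' \<union> {(B, i, j)})"
    by auto
  then show ?case
    unfolding valid_def by (simp add: ball_Un bex_Un; blast)
next
  case (NegL \<Gamma> \<Delta> A i j)
  then have "valid v (\<Gamma>, \<Delta> \<union> {(A, i, j)})"
    by auto
  then show ?case
    unfolding valid_def by (simp add: ball_Un bex_Un; blast)
next
  case (NegR \<Gamma> A i j \<Delta>)
  then have "valid v (\<Gamma> \<union> {(A, i, j)}, \<Delta>)"
    by auto
  then show ?case
    unfolding valid_def by (simp add: ball_Un bex_Un; blast)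
next
  case (ImpL \<Gamma> \<Delta> A k i \<Gamma>' B j \<Delta>')
  then have "valid v (\<Gamma>, \<Delta> \<union> {(A, k, i)})" "valid v (\<Gamma>' \<union> {(B, k, j)}, \<Delta>')"
    by auto
  then show ?case
    unfolding valid_def by (simp add: ball_Un bex_Un; blast)
qed

lemma logic_sound:
  assumes "A \<in> logic \<A>" and ax: "\<forall>T\<in>\<A>. valid v T"
  shows "rel v A x x"
proof -
  obtain ss where ss: "four_proof \<A> ss" and A: "({}, {(A, I0, I0)}) \<in> set ss"
    using assms(1) unfolding logic_def by blast
  have "n < length ss \<Longrightarrow> valid v (ss ! n)" for n
  proof (induction n rule: less_induct)
    case (less n)
    have "step \<A> (set (take n ss)) (ss ! n)"
      using ss less.prems unfolding four_proof_def by blast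
    moreover have "\<forall>T\<in>set (take n ss). valid v T"
    proof
      fix T assume "T \<in> set (take n ss)"
      then obtain m where "m < length (take n ss)" "T = take n ss ! m"
        unfolding in_set_conv_nth by blast
      then have "m < n" "T = ss ! m"
        using less.prems by simp_all
      then show "valid v T"
        using less.IH less.prems by simp
    qed
    ultimately show ?case
      using ax step_sound by blast
  qed
  then have "valid v ({}, {(A, I0, I0)})"
    using A unfolding in_set_conv_nth by metis
  from this[unfolded valid_def, rule_format, of "\<lambda>_. x"] show ?thesis
    by simp
qed

section \<open>Commutativity and density from affine invariance\<close>

definition affine_invariant :: "('a :: linordered_field \<Rightarrow> 'a \<Rightarrow> bool) \<Rightarrow> bool" where
  "affine_invariant R \<longleftrightarrow> (\<forall>a b x y. 0 < a \<longrightarrow> R (a * x + b) (a * y + b) = R x y)"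

lemma affine_invariantD:
  "affine_invariant R \<Longrightarrow> 0 < a \<Longrightarrow> R (a * x + b) (a * y + b) = R x y"
  unfolding affine_invariant_def by blast

text \<open>The quantifier in the residual is harmless because the maps in question are surjective.\<close>

lemma affine_invariant_rel:
  assumes "\<And>p. affine_invariant (v p)"
  shows "affine_invariant (rel v A)"
proof (induction A)
  case (Imp A B)
  have "rel v (A \<^bold>\<rightarrow> B) (a * x + b) (a * y + b) = rel v (A \<^bold>\<rightarrow> B) x y" if a: "0 < a" for a b x y
  proof -
    have onto: "(\<forall>z. Q z) \<longleftrightarrow> (\<forall>z. Q (a * z + b))" for Q
    proof (intro iffI allI)
      fix z assume "\<forall>z. Q (a * z + b)"
      from this[rule_format, of "(z - b) / a"] show "Q z"
        using a by simp
    qed simp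
    have "rel v (A \<^bold>\<rightarrow> B) (a * x + b) (a * y + b) \<longleftrightarrow>
        (\<forall>z. rel v A (a * z + b) (a * x + b) \<longrightarrow> rel v B (a * z + b) (a * y + b))"
      unfolding rel.simps by (rule onto)
    then show ?thesis
      using Imp a by (simp add: affine_invariantD)
  qed
  then show ?case
    unfolding affine_invariant_def by blast
qed (use assms in \<open>auto simp: affine_invariant_def\<close>)

text \<open>The point \<open>x + z - y\<close> is the fourth corner of the parallelogram: translating the two steps
  from \<open>x\<close> over \<open>y\<close> to \<open>z\<close> exchanges their order.\<close>

lemma affine_invariant_commute:
  assumes "affine_invariant R" "affine_invariant S" "R x y" "S y z"
  shows "\<exists>w. S x w \<and> R w z"
proof -
  have "S x (x + z - y)"
    using affine_invariantD[OF assms(2), of 1 y "x - y" z] assms(4) by (simp add: algebra_simps)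
  moreover have "R (x + z - y) z"
    using affine_invariantD[OF assms(1), of 1 x "z - y" y] assms(3) by (simp add: algebra_simps)
  ultimately show ?thesis
    by blast
qed

lemma affine_invariant_dense:
  assumes "affine_invariant R" "R x y"
  shows "\<exists>m. R x m \<and> R m y"
proof -
  have "R x ((x + y) / 2)"
    using affine_invariantD[OF assms(1), of "1/2" x "x/2" y] assms(2)
    by (simp add: add_divide_distrib add.commute)
  moreover have "R ((x + y) / 2) y"
    using affine_invariantD[OF assms(1), of "1/2" x "y/2" y] assms(2)
    by (simp add: add_divide_distrib)
  ultimately show ?thesis
    by blast
qed

text \<open>The last two schemes express density, and each of the first four an exchange of two
  neighbouring relations in a composition.\<close>

lemma plus_scheme_sound:
  fixes v :: "'v \<Rightarrow> 'a :: linordered_field \<Rightarrow> 'a \<Rightarrow> bool"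
  assumes v: "\<And>p. affine_invariant (v p)"
    and "X \<^bold>\<rightarrow> Y \<in> plus_schemes" and "rel v X x y"
  shows "rel v Y x y"
proof -
  have commute: "\<exists>w. rel v D a w \<and> rel v C w c" if "rel v C a b" "rel v D b c" for C D a b c
    using affine_invariant_commute[OF affine_invariant_rel[OF v] affine_invariant_rel[OF v] that] .
  have dense: "\<exists>m. rel v C a m \<and> rel v C m b" if "rel v C a b" for C a b
    using affine_invariant_dense[OF affine_invariant_rel[OF v] that] .
  from assms(2) show ?thesis
  proof cases
    case (1 A B)
    with assms(3) commute[of A _ _ B] show ?thesis
      by simp blast
  next
    case (2 A B C)
    with assms(3) commute[of A _ _ B] show ?thesis
      by simp blast
  next
    case (3 A B C)
    with assms(3) commute[of "B \<^bold>\<rightarrow> C" _ _ "A \<^bold>\<rightarrow> B"] show ?thesis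
      by simp blast
  next
    case (4 B)
    with assms(3) commute[of "X \<^bold>\<rightarrow> B" _ _ X] show ?thesis
      by simp blast
  next
    case (5 A B)
    with assms(3) dense[of A] show ?thesis
      by simp blast
  next
    case (6 A)
    with assms(3) dense[of A] show ?thesis
      by simp blast
  qed
qed

lemma plus_axioms_sound:
  fixes v :: "'v \<Rightarrow> 'a :: linordered_field \<Rightarrow> 'a \<Rightarrow> bool"
  assumes v: "\<And>p. affine_invariant (v p)"
  shows "\<forall>T\<in>plus_axioms. valid v T"
proof
  fix T :: "'v sequent" assume "T \<in> plus_axioms"
  then obtain \<Gamma> \<Delta> X Y i j where T: "T = (\<Gamma> \<union> {(X, i, j)}, \<Delta> \<union> {(Y, i, j)})"
    and XY: "X \<^bold>\<rightarrow> Y \<in> plus_schemes"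
    unfolding plus_axioms_def by blast
  have "rel v X x y \<longrightarrow> rel v Y x y" for x y
    using plus_scheme_sound[of v, OF v XY] by blast
  then show "valid v T"
    unfolding T valid_def by simp
qed

section \<open>The separating valuation\<close>

text \<open>The factor \<open>c\<close> only serves to treat the order (\<open>c = 1\<close>) and its converse (\<open>c = -1\<close>)
  at once. The complement of the converse exchanges the strict and the weak order; a residual is
  strict only from the weak to the strict order, and the residual from the strict to the weak
  order is weak because the order is dense.\<close>

lemma rel_strict_or_weak:
  fixes v :: "'v \<Rightarrow> 'a :: linordered_field \<Rightarrow> 'a \<Rightarrow> bool"
  assumes c: "c \<noteq> 0" and "\<And>p. p \<in> vars A \<Longrightarrow> v p = (\<lambda>x y. c * x < c * y)"
  shows "rel v A = (\<lambda>x y. c * x < c * y) \<or> rel v A = (\<lambda>x y. c * x \<le> c * y)"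
  using assms(2)
proof (induction A)
  case (Var p)
  then show ?case
    by (auto simp: fun_eq_iff)
next
  case (Or A B)
  then have "rel v A = (\<lambda>x y. c * x < c * y) \<or> rel v A = (\<lambda>x y. c * x \<le> c * y)"
    and "rel v B = (\<lambda>x y. c * x < c * y) \<or> rel v B = (\<lambda>x y. c * x \<le> c * y)"
    by simp_all
  then show ?case
    by (auto simp: fun_eq_iff)
next
  case (And A B)
  then have "rel v A = (\<lambda>x y. c * x < c * y) \<or> rel v A = (\<lambda>x y. c * x \<le> c * y)"
    and "rel v B = (\<lambda>x y. c * x < c * y) \<or> rel v B = (\<lambda>x y. c * x \<le> c * y)"
    by simp_all
  then show ?case
    by (auto simp: fun_eq_iff)
next
  case (Imp A B)
  then have A: "rel v A = (\<lambda>x y. c * x < c * y) \<or> rel v A = (\<lambda>x y. c * x \<le> c * y)"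
    and B: "rel v B = (\<lambda>x y. c * x < c * y) \<or> rel v B = (\<lambda>x y. c * x \<le> c * y)"
    by simp_all
  have range: "(\<forall>z. Q (c * z)) \<longleftrightarrow> (\<forall>u. Q u)" for Q
    using c by (metis nonzero_mult_div_cancel_left times_divide_eq_right)
  have "(\<forall>u. u < s \<longrightarrow> u < t) \<longleftrightarrow> s \<le> t" for s t :: 'a
    by (meson less_le_trans not_less order.irrefl)
  moreover have "(\<forall>u. u \<le> s \<longrightarrow> u \<le> t) \<longleftrightarrow> s \<le> t" for s t :: 'a
    by (meson order.refl order.trans)
  moreover have "(\<forall>u. u \<le> s \<longrightarrow> u < t) \<longleftrightarrow> s < t" for s t :: 'a
    by (meson order.refl le_less_trans)
  moreover have "(\<forall>u. u < s \<longrightarrow> u \<le> t) \<longleftrightarrow> s \<le> t" for s t :: 'a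
    by (meson dense_le less_imp_le order.trans)
  ultimately have "(\<forall>z. c * z < c * x \<longrightarrow> c * z < c * y) \<longleftrightarrow> c * x \<le> c * y"
    "(\<forall>z. c * z \<le> c * x \<longrightarrow> c * z \<le> c * y) \<longleftrightarrow> c * x \<le> c * y"
    "(\<forall>z. c * z \<le> c * x \<longrightarrow> c * z < c * y) \<longleftrightarrow> c * x < c * y"
    "(\<forall>z. c * z < c * x \<longrightarrow> c * z \<le> c * y) \<longleftrightarrow> c * x \<le> c * y" for x y
    using range[of "\<lambda>u. u < c * x \<longrightarrow> u < c * y"] range[of "\<lambda>u. u \<le> c * x \<longrightarrow> u \<le> c * y"]
      range[of "\<lambda>u. u \<le> c * x \<longrightarrow> u < c * y"] range[of "\<lambda>u. u < c * x \<longrightarrow> u \<le> c * y"]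
    by simp_all
  with A B show ?case
    by (elim disjE) (simp_all add: fun_eq_iff)
next
  case (Neg A)
  then have "rel v A = (\<lambda>x y. c * x < c * y) \<or> rel v A = (\<lambda>x y. c * x \<le> c * y)"
    by simp
  then show ?case
    by (auto simp: fun_eq_iff not_less not_le)
qed

lemma variable_sharing:
  assumes "A \<^bold>\<rightarrow> B \<in> logic \<A>"
    and sound: "\<And>v :: 'v \<Rightarrow> rat \<Rightarrow> rat \<Rightarrow> bool.
      (\<And>p. affine_invariant (v p)) \<Longrightarrow> \<forall>T\<in>\<A>. valid v T"
  shows "vars A \<inter> vars B \<noteq> {}"
proof
  assume disjoint: "vars A \<inter> vars B = {}"
  define c :: "'v \<Rightarrow> rat" where "c p = (if p \<in> vars A then 1 else -1)" for p
  define v where "v p x y \<longleftrightarrow> c p * x < c p * y" for p x y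
  have "affine_invariant (v p)" for p
    by (auto simp: affine_invariant_def v_def c_def)
  then have "\<forall>T\<in>\<A>. valid v T"
    by (rule sound)
  then have "rel v (A \<^bold>\<rightarrow> B) 0 0"
    by (rule logic_sound[OF assms(1)])
  then have "rel v A (-1) 0 \<longrightarrow> rel v B (-1) 0"
    by simp
  moreover have "rel v A (-1) 0"
    using rel_strict_or_weak[of 1 A v] by (auto simp: fun_eq_iff v_def c_def)
  moreover have "v p = (\<lambda>x y. -1 * x < -1 * y)" if "p \<in> vars B" for p
    using that disjoint by (auto simp: fun_eq_iff v_def c_def)
  then have "\<not> rel v B (-1) 0"
    using rel_strict_or_weak[of "-1" B v] by (auto simp: fun_eq_iff)
  ultimately show False
    by blast
qed

theorem mainTheorem2:
  fixes A B :: "'v :: countable fm"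
  shows "(A \<^bold>\<rightarrow> B \<in> L4 \<longrightarrow> vars A \<inter> vars B \<noteq> {}) \<and>
         (A \<^bold>\<rightarrow> B \<in> L4_plus \<longrightarrow> vars A \<inter> vars B \<noteq> {})"
proof (intro conjI impI)
  assume "A \<^bold>\<rightarrow> B \<in> L4"
  then show "vars A \<inter> vars B \<noteq> {}"
    unfolding L4_def by (rule variable_sharing) simp
next
  assume "A \<^bold>\<rightarrow> B \<in> L4_plus"
  then show "vars A \<inter> vars B \<noteq> {}"
    unfolding L4_plus_def by (rule variable_sharing) (rule plus_axioms_sound)
qed

end
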